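(* For every odd integer $r \geqslant 3$ there exists a constant $\epsilon = \epsilon(r) > 0$ such that, for all sufficiently large integers $k$, $R_{k}(C_{r}) > (r-1)(2+\epsilon)^{k-1}$.
   Context: A $k$-colouring of a graph is an assignment of one of $k$ colours to each of its edges (no properness condition is imposed). For a graph $H$, the $k$-colour Ramsey number $R_{k}(H)$ is the least integer $n$ such that every $k$-colouring of the edges of $K_{n}$ contains a monochromatic copy of $H$ (a not necessarily induced subgraph isomorphic to $H$ all of whose edges have the same colour). $C_{r}$ denotes the cycle of length $r$. *)

theory Defs
  imports Complex_Main "HOL-Library.Ramsey"
begin

record 'a ugraph =
  uverts :: "'a set"
  uedges :: "'a set set"

definition simple_graph :: "'a ugraph \<Rightarrow> bool" where
  "simple_graph G \<longleftrightarrow> finite (uverts G) \<and> uedges G \<subseteq> [uverts G]\<^bsup>2\<^esup>"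

definition subgraph_of :: "'a ugraph \<Rightarrow> 'a ugraph \<Rightarrow> bool" where
  "subgraph_of H G \<longleftrightarrow>
     simple_graph H \<and> simple_graph G \<and> uverts H \<subseteq> uverts G \<and> uedges H \<subseteq> uedges G"

definition isomorphic_graphs :: "'a ugraph \<Rightarrow> 'b ugraph \<Rightarrow> bool" where
  "isomorphic_graphs G H \<longleftrightarrow>
     (\<exists>f. bij_betw f (uverts G) (uverts H) \<and> (\<lambda>e. f ` e) ` uedges G = uedges H)"

definition complete_graph :: "nat \<Rightarrow> nat ugraph" where
  "complete_graph n = \<lparr>uverts = {..<n}, uedges = [{..<n}]\<^bsup>2\<^esup>\<rparr>"

text \<open>A genuine cycle only for \<open>r \<ge> 3\<close>.\<close>

definition cycle_graph :: "nat \<Rightarrow> nat ugraph" where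
  "cycle_graph r = \<lparr>uverts = {..<r}, uedges = (\<lambda>i. {i, (i + 1) mod r}) ` {..<r}\<rparr>"

definition edge_colouring :: "nat \<Rightarrow> 'a ugraph \<Rightarrow> ('a set \<Rightarrow> nat) \<Rightarrow> bool" where
  "edge_colouring k G c \<longleftrightarrow> c \<in> uedges G \<rightarrow> {..<k}"

definition monochromatic_copy :: "'b ugraph \<Rightarrow> 'a ugraph \<Rightarrow> ('a set \<Rightarrow> nat) \<Rightarrow> bool" where
  "monochromatic_copy H G c \<longleftrightarrow>
     (\<exists>H'. subgraph_of H' G \<and> isomorphic_graphs H' H \<and>
           (\<forall>e\<in>uedges H'. \<forall>e'\<in>uedges H'. c e = c e'))"

definition ramsey_number :: "nat \<Rightarrow> 'b ugraph \<Rightarrow> nat" where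
  "ramsey_number k H =
     (LEAST n. \<forall>c. edge_colouring k (complete_graph n) c \<longrightarrow>
                   monochromatic_copy H (complete_graph n) c)"

lemma simple_graph_complete_graph: "simple_graph (complete_graph n)"
  by (simp add: simple_graph_def complete_graph_def)

lemma simple_graph_cycle_graph:
  assumes "r \<ge> 3"
  shows "simple_graph (cycle_graph r)"
proof -
  have "i \<noteq> (i + 1) mod r" if "i < r" for i
    using that assms by (cases "i + 1 = r") auto
  then show ?thesis
    using assms by (auto simp: simple_graph_def cycle_graph_def)
qed

text \<open>The set whose least element defines \<^const>\<open>ramsey_number\<close> is nonempty for every
  finite simple graph, so \<open>LEAST\<close> never returns an unspecified value here.\<close>

lemma ramsey_number_exists:
  fixes H :: "'b ugraph"
  assumes H: "simple_graph H"
  shows "\<exists>n. \<forall>c. edge_colouring k (complete_graph n) c \<longrightarrow>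
                 monochromatic_copy H (complete_graph n) c"
proof -
  define m where "m = card (uverts H)"
  obtain N :: nat where N: "partn_lst {..<N} (replicate k m) 2"
    using ramsey_full by blast
  have "monochromatic_copy H (complete_graph N) c"
    if c: "edge_colouring k (complete_graph N) c" for c
  proof -
    have "c \<in> [{..<N}]\<^bsup>2\<^esup> \<rightarrow> {..<k}"
      using c by (simp add: edge_colouring_def complete_graph_def)
    then obtain i S where "i < k" "S \<in> [{..<N}]\<^bsup>(replicate k m ! i)\<^esup>"
      and cS: "c ` [S]\<^bsup>2\<^esup> \<subseteq> {i}"
      using N by (elim partn_lstE) auto
    then have S: "S \<in> [{..<N}]\<^bsup>m\<^esup>"
      by simp
    have "finite S" "card S = m" "S \<subseteq> {..<N}"
      using S by (auto simp: nsets_def)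
    then obtain g where g: "bij_betw g S (uverts H)"
      using H by (metis finite_same_card_bij m_def simple_graph_def)
    define f where "f = inv_into S g"
    have f: "bij_betw f (uverts H) S"
      unfolding f_def using g by (rule bij_betw_inv_into)
    define E where "E = (\<lambda>e. f ` e) ` uedges H"
    have sub: "e \<subseteq> uverts H" "card e = 2" if "e \<in> uedges H" for e
      using H that by (auto simp: simple_graph_def nsets_def)
    have ES: "E \<subseteq> [S]\<^bsup>2\<^esup>"
    proof
      fix e assume "e \<in> E"
      then obtain d where d: "d \<in> uedges H" "e = f ` d"
        by (auto simp: E_def)
      have "card e = 2"
        using sub[OF d(1)] d(2) f by (metis bij_betw_def card_image inj_on_subset)
      moreover have "e \<subseteq> S"
        using sub[OF d(1)] d(2) f by (auto simp: bij_betw_def)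
      ultimately show "e \<in> [S]\<^bsup>2\<^esup>"
        using \<open>finite S\<close> by (auto simp: nsets_def intro: finite_subset)
    qed
    have gf: "g ` f ` e = e" if "e \<in> uedges H" for e
      using sub[OF that] g by (metis bij_betw_imp_surj_on f_def image_inv_into_cancel)
    have "(\<lambda>e. g ` e) ` E = uedges H"
      unfolding E_def image_image[of "\<lambda>e. g ` e"] by (simp only: gf image_ident cong: image_cong)
    then have "isomorphic_graphs \<lparr>uverts = S, uedges = E\<rparr> H"
      using g by (auto simp: isomorphic_graphs_def)
    moreover have "subgraph_of \<lparr>uverts = S, uedges = E\<rparr> (complete_graph N)"
      using ES \<open>finite S\<close> \<open>S \<subseteq> {..<N}\<close> nsets_mono[OF \<open>S \<subseteq> {..<N}\<close>, of 2]
      by (auto simp: subgraph_of_def simple_graph_def complete_graph_def)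
    moreover have "c e = c e'" if "e \<in> E" "e' \<in> E" for e e'
      using that ES cS by blast
    ultimately show ?thesis
      unfolding monochromatic_copy_def by (metis select_convs(2))
  qed
  then show ?thesis by blast
qed

end

theory Submission
  imports Defs "HOL-Number_Theory.Cong"
begin

text \<open>
  Let a pair of vertices be coloured by a coordinate in which their labels are neighbours on the
  cycle of length \<open>m = 2 n + 3\<close>. Then a monochromatic closed walk of odd length below \<open>m\<close> would
  wind around the cycle, which is impossible. So it suffices to label \<open>2 ^ d + 1\<close> vertices by
  vectors in \<open>(\<int>/m)\<^sup>d\<close> that are pairwise neighbours in some coordinate (a clique of the kind that
  Bohman and Holzman used for the Shannon capacity of complements of odd cycles). One of the vertices
  has the constant label \<open>2 n + 2\<close>; the others are obtained by a doubling construction from \<open>n\<close>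
  to \<open>n + 1\<close> and \<open>d\<close> to \<open>2 d\<close>. Colourings without monochromatic closed
  walks of length \<open>r\<close> can be multiplied, which gives about \<open>(2 ^ d + 1) ^ (k / d)\<close> vertices for
  \<open>k\<close> colours; blowing up each vertex to \<open>r - 1\<close> vertices costs one more colour.
\<close>

section \<open>Colourings without monochromatic closed walks\<close>

text \<open>Walks may repeat vertices: a cycle in a product projects to a factor only as a walk, so
  forbidding cycles alone would not be preserved by products. Values of \<open>c\<close> on the
  diagonal are unconstrained.\<close>

definition no_mono_closed_walk :: "nat \<Rightarrow> nat \<Rightarrow> nat \<Rightarrow> (nat \<Rightarrow> nat \<Rightarrow> nat) \<Rightarrow> bool" where
  "no_mono_closed_walk r n k c \<longleftrightarrow>
     (\<forall>x<n. \<forall>y<n. x \<noteq> y \<longrightarrow> c x y = c y x \<and> c x y < k) \<and>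
     (\<forall>w i. (\<forall>p\<le>r. w p < n) \<and> (\<forall>p<r. w p \<noteq> w (Suc p) \<and> c (w p) (w (Suc p)) = i) \<longrightarrow> w r \<noteq> w 0)"

lemma no_mono_closed_walkD:
  assumes "no_mono_closed_walk r n k c"
  shows "\<lbrakk>x < n; y < n; x \<noteq> y\<rbrakk> \<Longrightarrow> c x y = c y x"
    and "\<lbrakk>x < n; y < n; x \<noteq> y\<rbrakk> \<Longrightarrow> c x y < k"
    and "\<lbrakk>\<And>p. p \<le> r \<Longrightarrow> w p < n; \<And>p. p < r \<Longrightarrow> w p \<noteq> w (Suc p);
          \<And>p. p < r \<Longrightarrow> c (w p) (w (Suc p)) = i\<rbrakk> \<Longrightarrow> w r \<noteq> w 0"
  using assms unfolding no_mono_closed_walk_def by blast+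

section \<open>Walks around a cycle\<close>

definition cycle_adjacent :: "int \<Rightarrow> int \<Rightarrow> int \<Rightarrow> bool" where
  "cycle_adjacent m a b \<longleftrightarrow> [b = a + 1] (mod m) \<or> [a = b + 1] (mod m)"

lemma cycle_adjacent_commute: "cycle_adjacent m a b \<longleftrightarrow> cycle_adjacent m b a"
  by (auto simp: cycle_adjacent_def)

text \<open>Each step changes the residue by +1 or -1; \<open>s\<close> is the sum of these
  \<open>r\<close> signs.\<close>

lemma cycle_walk_displacement:
  assumes "\<And>p. p < r \<Longrightarrow> cycle_adjacent m (a p) (a (Suc p))"
  shows "\<exists>s. [a r = a 0 + s] (mod m) \<and> \<bar>s\<bar> \<le> int r \<and> even (s + int r)"
  using assms
proof (induction r)
  case 0
  show ?case by (rule exI[of _ 0]) simp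
next
  case (Suc r)
  then obtain s where s: "[a r = a 0 + s] (mod m)" "\<bar>s\<bar> \<le> int r" "even (s + int r)"
    by auto
  have "cycle_adjacent m (a r) (a (Suc r))"
    using Suc.prems by simp
  then consider "[a (Suc r) = a r + 1] (mod m)" | "[a r = a (Suc r) + 1] (mod m)"
    by (auto simp: cycle_adjacent_def)
  then show ?case
  proof cases
    case 1
    have "[a (Suc r) = a 0 + (s + 1)] (mod m)"
      using cong_trans[OF 1 cong_add[OF s(1) cong_refl[of 1]]] by (simp add: add.assoc)
    then show ?thesis using s by (intro exI[of _ "s + 1"]) auto
  next
    case 2
    have "[a (Suc r) + 1 - 1 = a 0 + s - 1] (mod m)"
      by (intro cong_diff cong_refl cong_trans[OF cong_sym[OF 2] s(1)])
    then have "[a (Suc r) = a 0 + (s - 1)] (mod m)"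
      by (simp add: algebra_simps)
    then show ?thesis using s by (intro exI[of _ "s - 1"]) auto
  qed
qed

text \<open>In the coordinate named by its colour, a monochromatic closed walk has a displacement
  divisible by \<open>m\<close> and of absolute value at most \<open>r < m\<close>. So it is 0, but
  an odd number of signs cannot sum to 0.\<close>

lemma no_mono_closed_walk_from_labels:
  fixes H :: "nat \<Rightarrow> nat \<Rightarrow> int"
  assumes "odd r" and "int r < m"
    and lab: "\<And>u v. u < n \<Longrightarrow> v < n \<Longrightarrow> u \<noteq> v \<Longrightarrow> \<exists>i<k. cycle_adjacent m (H u i) (H v i)"
  shows "\<exists>c. no_mono_closed_walk r n k c"
proof -
  \<comment> \<open>Taking the least suitable coordinate makes the choice symmetric in
    \<open>u\<close> and \<open>v\<close>.\<close>
  define c where "c u v = (LEAST i. cycle_adjacent m (H u i) (H v i))" for u v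
  have c: "c u v < k" "cycle_adjacent m (H u (c u v)) (H v (c u v))"
    if uv: "u < n" "v < n" "u \<noteq> v" for u v
  proof -
    obtain i where i: "i < k" "cycle_adjacent m (H u i) (H v i)"
      using lab[OF uv] by blast
    then have "c u v \<le> i"
      unfolding c_def by (intro Least_le)
    with i show "c u v < k" by simp
    show "cycle_adjacent m (H u (c u v)) (H v (c u v))"
      unfolding c_def using i(2) by (rule LeastI)
  qed
  have sym: "c u v = c v u" for u v
    unfolding c_def by (simp add: cycle_adjacent_commute)
  have "w r \<noteq> w 0"
    if w: "\<forall>p\<le>r. w p < n" "\<forall>p<r. w p \<noteq> w (Suc p) \<and> c (w p) (w (Suc p)) = i" for w i
  proof
    assume eq: "w r = w 0"
    have "cycle_adjacent m (H (w p) i) (H (w (Suc p)) i)" if "p < r" for p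
      using c(2)[of "w p" "w (Suc p)"] w that by auto
    from cycle_walk_displacement[of r m "\<lambda>p. H (w p) i", OF this]
    obtain s where s: "[H (w r) i = H (w 0) i + s] (mod m)" "\<bar>s\<bar> \<le> int r" "even (s + int r)"
      by auto
    have "m dvd s"
      using s(1) eq by (simp add: cong_iff_dvd_diff)
    moreover have "\<bar>s\<bar> < m"
      using s(2) assms(2) by simp
    ultimately have "s = 0"
      using dvd_imp_le_int by force
    then show False using s(3) assms(1) by simp
  qed
  then show ?thesis
    unfolding no_mono_closed_walk_def using c sym by (intro exI[of _ c]) blast
qed

section \<open>Label vectors by doubling\<close>

lemma bit_differs_below:
  fixes a b d :: nat
  assumes "a < 2 ^ d" "b < 2 ^ d" "a \<noteq> b"
  shows "\<exists>j<d. bit a j \<noteq> bit b j"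
proof (rule ccontr)
  assume *: "\<not> ?thesis"
  have "bit (take_bit d a) j = bit (take_bit d b) j" for j
    using * by (auto simp: bit_take_bit_iff)
  then have "take_bit d a = take_bit d b"
    by (simp add: bit_eq_iff)
  then show False
    using assms by (simp add: take_bit_nat_eq_self)
qed

text \<open>Equal bits keep the difference in the first alternative. For unequal bits note that
  \<open>x + x mod 2\<close> rounds up to an even number. The pair 2a-1, 2a is rounded to the same
  value and the bits separate it. For 2a, 2a+1 the bits 1, 0 give 2a+1, 2a+2 in the second
  alternative, and the bits 0, 1 give 2a+2, 2a+1 in the first.\<close>

lemma doubled_labels_neighbours:
  fixes x y b b' :: int
  assumes "\<bar>x - y\<bar> = 1" and b: "b = 0 \<or> b = 1" "b' = 0 \<or> b' = 1"
  shows "\<bar>(x + 2 * (1 - b)) - (y + 2 * (1 - b'))\<bar> = 1 \<or>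
    \<bar>(x + x mod 2 + b) - (y + y mod 2 + b')\<bar> = 1"
proof -
  have mod: "(z + 1) mod 2 = 1 - z mod 2" "z mod 2 = 0 \<or> z mod 2 = 1" for z :: int
    by presburger+
  consider "x = y + 1" | "y = x + 1"
    using assms(1) by linarith
  then show ?thesis
  proof cases
    case 1
    show ?thesis
      unfolding 1 mod(1) using b mod(2)[of y] by (elim disjE) simp_all
  next
    case 2
    show ?thesis
      unfolding 2 mod(1) using b mod(2)[of x] by (elim disjE) simp_all
  qed
qed

text \<open>Deleting 2n+2 from the cycle of length 2n+3 leaves a path with ends 0 and 2n+1. The
  first condition thus makes every label vector a neighbour of the constant vector 2n+2 in some
  coordinate.\<close>

definition path_labels :: "nat \<Rightarrow> nat \<Rightarrow> (nat \<Rightarrow> nat \<Rightarrow> int) \<Rightarrow> bool" where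
  "path_labels n d h \<longleftrightarrow>
     (\<forall>v<2 ^ d. \<exists>i<d. h v i = 0 \<or> h v i = 2 * int n + 1) \<and>
     (\<forall>u<2 ^ d. \<forall>v<2 ^ d. u \<noteq> v \<longrightarrow> (\<exists>i<d. \<bar>h u i - h v i\<bar> = 1))"

lemma path_labelsD:
  assumes "path_labels n d h"
  shows "v < 2 ^ d \<Longrightarrow> \<exists>i<d. h v i = 0 \<or> h v i = 2 * int n + 1"
    and "\<lbrakk>u < 2 ^ d; v < 2 ^ d; u \<noteq> v\<rbrakk> \<Longrightarrow> \<exists>i<d. \<bar>h u i - h v i\<bar> = 1"
  using assms unfolding path_labels_def by auto

text \<open>
  Since \<open>h a j\<close> and \<open>h a' j\<close> have different parity whenever they are neighbours, the parity of
  \<open>h a j\<close> plays the role of a bit of \<open>a\<close>.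
\<close>

lemma path_labels_exist: "\<exists>d>0. \<exists>h. path_labels n d h"
proof (induction n)
  case 0
  \<comment> \<open>For \<open>n = 0\<close> the labels 0 and 1 are the two ends of a path with one
    edge.\<close>
  have "\<bar>int u - int v\<bar> = 1" if "u < 2" "v < 2" "u \<noteq> v" for u v :: nat
    using that by auto
  then have "path_labels 0 1 (\<lambda>v i. int v)"
    by (auto simp: path_labels_def)
  then show ?case by (intro exI[of _ 1]) auto
next
  case (Suc n)
  obtain d h where d: "d > 0" and h: "path_labels n d h"
    using Suc by blast
  note ext = path_labelsD(1)[OF h] and adj = path_labelsD(2)[OF h]
  \<comment> \<open>A new vertex \<open>v\<close> is a pair: \<open>v div D\<close> selects an old
    label vector and \<open>v mod D\<close> supplies \<open>d\<close> fresh bits.\<close>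
  define D :: nat where "D = 2 ^ d"
  have D: "D > 0" by (simp add: D_def)
  have DD: "2 ^ (2 * d) = D * D"
    by (simp add: D_def power2_eq_square mult_2 power_add)
  define b :: "nat \<Rightarrow> nat \<Rightarrow> int" where "b v j = of_bool (bit (v mod D) j)" for v j
  \<comment> \<open>Each old coordinate is split into two, and both formulas map 0..2n+1 into
    0..2n+3.\<close>
  define h1 where "h1 v j = h (v div D) j + 2 * (1 - b v j)" for v j
  define h2 where "h2 v j = h (v div D) j + h (v div D) j mod 2 + b v j" for v j
  define h' where "h' v i = (if i < d then h1 v i else h2 v (i - d))" for v i
  have b: "b v j = 0 \<or> b v j = 1" for v j
    by (simp add: b_def)
  have pick: "\<exists>i<2 * d. P (h' u i) (h' v i)"
    if "j < d" "P (h1 u j) (h1 v j) \<or> P (h2 u j) (h2 v j)" for P u v j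
  proof (cases "P (h1 u j) (h1 v j)")
    case True
    then show ?thesis using that by (intro exI[of _ j]) (auto simp: h'_def)
  next
    case False
    then show ?thesis using that by (intro exI[of _ "d + j"]) (auto simp: h'_def)
  qed
  have "\<exists>i<2 * d. h' v i = 0 \<or> h' v i = 2 * int (Suc n) + 1" if v: "v < 2 ^ (2 * d)" for v
  proof -
    have "v div D < D"
      using v by (simp add: DD less_mult_imp_div_less)
    then obtain j where j: "j < d" "h (v div D) j = 0 \<or> h (v div D) j = 2 * int n + 1"
      using ext unfolding D_def by blast
    \<comment> \<open>An old end 0 becomes 0 in \<open>h1\<close> if the bit is 1 and in
      \<open>h2\<close> if it is 0; an old end 2n+1 becomes 2n+3 in \<open>h1\<close> if the bit is
      0 and in \<open>h2\<close> if it is 1.\<close>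
    show ?thesis
      by (rule pick[OF j(1), of "\<lambda>x y. x = 0 \<or> x = 2 * int (Suc n) + 1" v v])
        (use j(2) b[of v j] in \<open>auto simp: h1_def h2_def\<close>)
  qed
  moreover have "\<exists>i<2 * d. \<bar>h' u i - h' v i\<bar> = 1"
    if uv: "u < 2 ^ (2 * d)" "v < 2 ^ (2 * d)" "u \<noteq> v" for u v
  proof (cases "u div D = v div D")
    case True
    then have "u mod D \<noteq> v mod D"
      using uv(3) by (metis div_mod_decomp)
    then obtain j where j: "j < d" "bit (u mod D) j \<noteq> bit (v mod D) j"
      using bit_differs_below[of "u mod D" d "v mod D"] D by (auto simp: D_def)
    \<comment> \<open>With the same old label, the values of \<open>h2\<close> differ exactly by the
      differing bit.\<close>
    show ?thesis
      by (rule pick[OF j(1), of "\<lambda>x y. \<bar>x - y\<bar> = 1"])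
        (use j(2) True in \<open>auto simp: h2_def b_def\<close>)
  next
    case False
    have "u div D < D" "v div D < D"
      using uv by (simp_all add: DD less_mult_imp_div_less)
    then obtain j where j: "j < d" "\<bar>h (u div D) j - h (v div D) j\<bar> = 1"
      using adj False unfolding D_def by blast
    show ?thesis
      by (rule pick[OF j(1), of "\<lambda>x y. \<bar>x - y\<bar> = 1"])
        (use doubled_labels_neighbours[OF j(2) b[of u j] b[of v j]] in \<open>simp add: h1_def h2_def\<close>)
  qed
  ultimately have "path_labels (Suc n) (2 * d) h'"
    unfolding path_labels_def by blast
  then show ?case
    using d by (intro exI[of _ "2 * d"]) auto
qed

section \<open>Two basic colourings\<close>

text \<open>Products of single edges reach 2^d vertices with \<open>d\<close> colours; the one
  vertex gained here is what makes the base exceed 2.\<close>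

lemma no_mono_closed_walk_beyond_power2:
  assumes "odd r"
  shows "\<exists>d>0. \<exists>c. no_mono_closed_walk r (2 ^ d + 1) d c"
proof -
  \<comment> \<open>This is the cycle length 2n+3 for \<open>n = r\<close>, and it exceeds
    \<open>r\<close>.\<close>
  define m where "m = 3 + 2 * int r"
  obtain d h where d: "d > 0" and h: "path_labels r d h"
    using path_labels_exist[of r] by blast
  note ext = path_labelsD(1)[OF h] and adj = path_labelsD(2)[OF h]
  \<comment> \<open>The extra vertex 2^d has every coordinate equal to -1 modulo \<open>m\<close>,
    whose neighbours are the path ends 0 and 2r+1.\<close>
  define H where "H v i = (if v < 2 ^ d then h v i else 2 * int r + 2)" for v i
  have near: "cycle_adjacent m x y" if "\<bar>x - y\<bar> = 1" for x y
  proof -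
    have "y = x + 1 \<or> x = y + 1" using that by auto
    then show ?thesis by (auto simp: cycle_adjacent_def)
  qed
  have apex: "cycle_adjacent m x (2 * int r + 2)" if "x = 0 \<or> x = 2 * int r + 1" for x
    using that by (auto simp: cycle_adjacent_def m_def cong_def)
  have "\<exists>i<d. cycle_adjacent m (H u i) (H v i)"
    if uv: "u < 2 ^ d + 1" "v < 2 ^ d + 1" "u \<noteq> v" for u v
  proof -
    consider "u < 2 ^ d" "v < 2 ^ d" | "u < 2 ^ d" "v = 2 ^ d" | "u = 2 ^ d" "v < 2 ^ d"
      using uv by linarith
    then show ?thesis
    proof cases
      case 1
      with adj[OF 1 uv(3)] show ?thesis by (metis H_def near)
    next
      case 2
      with ext[OF 2(1)] show ?thesis by (metis H_def apex less_irrefl)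
    next
      case 3
      with ext[OF 3(2)] show ?thesis by (metis H_def apex less_irrefl cycle_adjacent_commute)
    qed
  qed
  then have "\<exists>c. no_mono_closed_walk r (2 ^ d + 1) d c"
    using assms by (intro no_mono_closed_walk_from_labels[where m = m and H = H]) (auto simp: m_def)
  with d show ?thesis by blast
qed

text \<open>A single edge has no closed walk of odd length. It uses up the colours left over when
  the total is not a multiple of \<open>d\<close>.\<close>

lemma no_mono_closed_walk_two:
  assumes "odd r"
  shows "\<exists>c. no_mono_closed_walk r 2 1 c"
proof (rule no_mono_closed_walk_from_labels[where m = "int r + 1" and H = "\<lambda>v i. int v"])
  show "\<exists>i<(1::nat). cycle_adjacent (int r + 1) (int u) (int v)" if "u < 2" "v < 2" "u \<noteq> v" for u v
  proof -
    have "int v = int u + 1 \<or> int u = int v + 1" using that by linarith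
    then show ?thesis by (auto simp: cycle_adjacent_def)
  qed
qed (use assms in auto)

lemma no_mono_closed_walk_one:
  assumes "r > 0"
  shows "no_mono_closed_walk r 1 0 c"
proof -
  have False if "\<forall>p\<le>r. w p < 1" "\<forall>p<r. w p \<noteq> w (Suc p)" for w :: "nat \<Rightarrow> nat"
  proof -
    have "w 0 = 0" "w (Suc 0) = 0"
      using that(1) assms by (simp_all add: Suc_le_eq)
    then show False using that(2) assms by auto
  qed
  then show ?thesis
    unfolding no_mono_closed_walk_def by (intro conjI, simp) blast
qed

section \<open>Products of colourings\<close>

text \<open>This is the lexicographic product: blocks of \<open>m\<close> vertices, with colours of
  \<open>c\<close> between blocks and colours shifted by \<open>k\<close> inside, so that the two
  palettes are disjoint.\<close>

definition prod_colouring ::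
  "nat \<Rightarrow> nat \<Rightarrow> (nat \<Rightarrow> nat \<Rightarrow> nat) \<Rightarrow> (nat \<Rightarrow> nat \<Rightarrow> nat) \<Rightarrow> nat \<Rightarrow> nat \<Rightarrow> nat" where
  "prod_colouring m k c c' u v =
     (if u div m \<noteq> v div m then c (u div m) (v div m) else k + c' (u mod m) (v mod m))"

lemma prod_colouring_less_iff:
  assumes "no_mono_closed_walk r n k c" "u < n * m" "v < n * m"
  shows "prod_colouring m k c c' u v < k \<longleftrightarrow> u div m \<noteq> v div m"
  using no_mono_closed_walkD(2)[OF assms(1), of "u div m" "v div m"] assms(2,3)
  by (auto simp: prod_colouring_def less_mult_imp_div_less)

text \<open>A colour below \<open>k\<close> changes the block at every step, so the sequence of
  blocks is a monochromatic walk for \<open>c\<close>. As \<open>c'\<close> is arbitrary, this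
  serves both the product and the blow-up.\<close>

lemma prod_colouring_no_closed_walk_outer:
  assumes c: "no_mono_closed_walk r n k c" and "i < k"
    and w: "\<And>p. p \<le> r \<Longrightarrow> w p < n * m"
    and i: "\<And>p. p < r \<Longrightarrow> prod_colouring m k c c' (w p) (w (Suc p)) = i"
  shows "w r \<noteq> w 0"
proof -
  have ne: "w p div m \<noteq> w (Suc p) div m" if "p < r" for p
    using prod_colouring_less_iff[OF c w w, of p "Suc p" c'] i[OF that] \<open>i < k\<close> that by simp
  have "w r div m \<noteq> w 0 div m"
    using no_mono_closed_walkD(3)[OF c, of "\<lambda>p. w p div m" i] w i ne
    by (simp add: prod_colouring_def less_mult_imp_div_less)
  then show ?thesis by auto
qed

lemma prod_colouring_walk_inner:
  assumes c: "no_mono_closed_walk r n k c" and "\<not> i < k"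
    and w: "\<And>p. p \<le> r \<Longrightarrow> w p < n * m"
    and i: "\<And>p. p < r \<Longrightarrow> prod_colouring m k c c' (w p) (w (Suc p)) = i"
    and "p \<le> r"
  shows "w p div m = w 0 div m"
  using \<open>p \<le> r\<close>
proof (induction p)
  case (Suc p)
  then show ?case
    using prod_colouring_less_iff[OF c w w, of p "Suc p" c'] i[of p] \<open>\<not> i < k\<close> by simp
qed simp

lemma div_neq_imp_mod_neq:
  fixes u v m :: nat
  assumes "u \<noteq> v" "u div m = v div m"
  shows "u mod m \<noteq> v mod m"
  using assms by (metis div_mod_decomp)

lemma prod_colouring_range:
  assumes c: "no_mono_closed_walk r n k c"
    and c': "\<And>x y. x < m \<Longrightarrow> y < m \<Longrightarrow> x \<noteq> y \<Longrightarrow> c' x y = c' y x \<and> c' x y < l"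
    and uv: "u < n * m" "v < n * m" "u \<noteq> v"
  shows "prod_colouring m k c c' u v = prod_colouring m k c c' v u"
    and "prod_colouring m k c c' u v < k + l"
proof -
  have div: "u div m < n" "v div m < n"
    using uv by (auto simp: less_mult_imp_div_less)
  have mod: "u mod m < m" "v mod m < m"
    using uv(1) by (cases "m = 0"; simp)+
  have 1: "prod_colouring m k c c' u v = prod_colouring m k c c' v u \<and>
      prod_colouring m k c c' u v < k + l"
  proof (cases "u div m = v div m")
    case True
    then show ?thesis
      using c'[OF mod div_neq_imp_mod_neq[OF uv(3) True]] by (simp add: prod_colouring_def)
  next
    case False
    then show ?thesis
      using no_mono_closed_walkD(1,2)[OF c div False] by (simp add: prod_colouring_def)
  qed
  then show "prod_colouring m k c c' u v = prod_colouring m k c c' v u"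
    and "prod_colouring m k c c' u v < k + l" by auto
qed

text \<open>A monochromatic walk either changes block at every step or never does, so it projects to
  a monochromatic walk of the same length in one factor.\<close>

lemma no_mono_closed_walk_prod:
  assumes c: "no_mono_closed_walk r n k c" and c': "no_mono_closed_walk r m l c'"
  shows "no_mono_closed_walk r (n * m) (k + l) (prod_colouring m k c c')"
  unfolding no_mono_closed_walk_def
proof (intro conjI allI impI)
  fix w i
  assume "(\<forall>p\<le>r. w p < n * m) \<and>
    (\<forall>p<r. w p \<noteq> w (Suc p) \<and> prod_colouring m k c c' (w p) (w (Suc p)) = i)"
  then have w: "\<And>p. p \<le> r \<Longrightarrow> w p < n * m"
    and ne: "\<And>p. p < r \<Longrightarrow> w p \<noteq> w (Suc p)"
    and i: "\<And>p. p < r \<Longrightarrow> prod_colouring m k c c' (w p) (w (Suc p)) = i" by auto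
  show "w r \<noteq> w 0"
  proof (cases "i < k")
    case True
    from prod_colouring_no_closed_walk_outer[where w = w, OF c True w i] show ?thesis .
  next
    case False
    note block = prod_colouring_walk_inner[where w = w, OF c False w i]
    have same: "w p div m = w (Suc p) div m" if "p < r" for p
      using block[of p] block[of "Suc p"] that by simp
    have "m > 0" using w[of 0] by (auto intro!: gr0I)
    have "w r mod m \<noteq> w 0 mod m"
    proof (rule no_mono_closed_walkD(3)[OF c', of "\<lambda>p. w p mod m" "i - k"])
      show "w p mod m < m" for p using \<open>m > 0\<close> by simp
      show "w p mod m \<noteq> w (Suc p) mod m" if "p < r" for p
        using div_neq_imp_mod_neq[OF ne[OF that] same[OF that]] .
      show "c' (w p mod m) (w (Suc p) mod m) = i - k" if "p < r" for p
        using i[OF that] same[OF that] by (auto simp: prod_colouring_def)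
    qed
    then show ?thesis by auto
  qed
qed (use prod_colouring_range[OF c, of m c' l] no_mono_closed_walkD[OF c'] in auto)

lemma no_mono_closed_walk_power:
  assumes c: "no_mono_closed_walk r n k c" and "r > 0"
  shows "\<exists>c. no_mono_closed_walk r (n ^ t) (t * k) c"
proof (induction t)
  case 0
  show ?case using no_mono_closed_walk_one[OF \<open>r > 0\<close>] by auto
next
  case (Suc t)
  then show ?case
    using no_mono_closed_walk_prod[OF c] by auto
qed

section \<open>From closed walks to Ramsey numbers\<close>

lemma monochromatic_cycle_walk:
  assumes "monochromatic_copy (cycle_graph r) (complete_graph n) C" and "r \<ge> 3"
  obtains w i where "\<And>p. w p < n" "inj_on w {..<r}" "w r = w 0"
    "\<And>p. p < r \<Longrightarrow> w p \<noteq> w (Suc p)" "\<And>p. p < r \<Longrightarrow> C {w p, w (Suc p)} = i"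
proof -
  obtain H' f where sub: "subgraph_of H' (complete_graph n)"
    and f: "bij_betw f (uverts H') {..<r}"
    and E: "(\<lambda>e. f ` e) ` uedges H' = (\<lambda>i. {i, (i + 1) mod r}) ` {..<r}"
    and mono: "\<And>e e'. e \<in> uedges H' \<Longrightarrow> e' \<in> uedges H' \<Longrightarrow> C e = C e'"
    using assms(1)
    unfolding monochromatic_copy_def isomorphic_graphs_def cycle_graph_def by auto
  define g where "g = inv_into (uverts H') f"
  \<comment> \<open>Reduction modulo \<open>r\<close> closes the walk, so the last step is the
    wrap-around edge of the cycle.\<close>
  define w where "w p = g (p mod r)" for p
  have g: "bij_betw g {..<r} (uverts H')"
    unfolding g_def using f by (rule bij_betw_inv_into)
  have "r > 0" using assms(2) by simp
  have V: "uverts H' \<subseteq> {..<n}" and EV: "uedges H' \<subseteq> [uverts H']\<^bsup>2\<^esup>"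
    using sub by (auto simp: subgraph_of_def simple_graph_def complete_graph_def)
  have edge: "{w p, w (Suc p)} \<in> uedges H'" if "p < r" for p
  proof -
    have "{p, (p + 1) mod r} \<in> (\<lambda>e. f ` e) ` uedges H'"
      using E that by blast
    then obtain e where e: "e \<in> uedges H'" "f ` e = {p, (p + 1) mod r}"
      by auto
    have "e \<subseteq> uverts H'"
      using e(1) EV by (auto simp: nsets_def)
    then have "e = g ` f ` e"
      using f unfolding g_def bij_betw_def by (simp add: inv_into_image_cancel)
    then have "e = {w p, w (Suc p)}"
      using e(2) that by (simp add: w_def)
    with e(1) show ?thesis by simp
  qed
  show thesis
  proof
    show "w p < n" for p
      using g V \<open>r > 0\<close> by (auto simp: w_def bij_betw_def)
    show "inj_on w {..<r}"
      using g by (auto simp: w_def bij_betw_def inj_on_def)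
    show "w r = w 0" by (simp add: w_def)
    show "w p \<noteq> w (Suc p)" if "p < r" for p
    proof -
      have "card {w p, w (Suc p)} = 2"
        using edge[OF that] EV by (auto simp: nsets_def)
      then show ?thesis by auto
    qed
    show "C {w p, w (Suc p)} = C {w 0, w (Suc 0)}" if "p < r" for p
      using mono edge that \<open>r > 0\<close> by blast
  qed
qed

text \<open>Each vertex is blown up to a block of \<open>r - 1\<close> vertices, with one new colour
  inside blocks. A cycle in the new colour would stay in one block, which has too few vertices for
  it.\<close>

lemma ramsey_number_cycle_gt:
  assumes c: "no_mono_closed_walk r N k c" and r: "r \<ge> 3"
  shows "ramsey_number (k + 1) (cycle_graph r) > N * (r - 1)"
proof (rule ccontr)
  define n where "n = ramsey_number (k + 1) (cycle_graph r)"
  assume "\<not> ?thesis"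
  then have n: "n \<le> N * (r - 1)" by (simp add: n_def)
  \<comment> \<open>The constant inner colour 0 becomes the new colour \<open>k\<close> after the
    shift.\<close>
  define col where "col = prod_colouring (r - 1) k c (\<lambda>_ _. 0)"
  \<comment> \<open>The minimum and maximum order the endpoints of an edge; symmetry of
    \<open>col\<close> makes the order immaterial.\<close>
  define C where "C e = col (Min e) (Max e)" for e :: "nat set"
  have range: "col u v = col v u" "col u v < k + 1" if "u < n" "v < n" "u \<noteq> v" for u v
    using prod_colouring_range[OF c, of "r - 1" "\<lambda>_ _. 0" 1 u v] that n by (auto simp: col_def)
  have C_pair: "C {u, v} = col u v" if "u < n" "v < n" "u \<noteq> v" for u v
    using range[OF that] by (auto simp: C_def min_def max_def)
  have "edge_colouring (k + 1) (complete_graph n) C"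
    using range(2) C_pair
    by (fastforce simp: edge_colouring_def complete_graph_def nsets_def card_2_iff)
  then have "monochromatic_copy (cycle_graph r) (complete_graph n) C"
    using LeastI_ex[OF ramsey_number_exists[OF simple_graph_cycle_graph[OF r], of "k + 1"]]
    unfolding n_def ramsey_number_def by blast
  then obtain w i where w: "\<And>p. w p < n" "inj_on w {..<r}" "w r = w 0"
    and ne: "\<And>p. p < r \<Longrightarrow> w p \<noteq> w (Suc p)" and "\<And>p. p < r \<Longrightarrow> C {w p, w (Suc p)} = i"
    using r by (rule monochromatic_cycle_walk) blast
  then have i: "prod_colouring (r - 1) k c (\<lambda>_ _. 0) (w p) (w (Suc p)) = i" if "p < r" for p
    using C_pair[OF w(1) w(1) ne] that by (metis col_def)
  have wN: "w p < N * (r - 1)" for p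
    using w(1)[of p] n by simp
  show False
  proof (cases "i < k")
    case True
    from prod_colouring_no_closed_walk_outer[where w = w, OF c True wN i] w(3) show False by simp
  next
    case False
    note block = prod_colouring_walk_inner[where w = w, OF c False wN i]
    have "inj_on (\<lambda>p. w p mod (r - 1)) {..<r}"
    proof (rule inj_onI)
      fix p q assume pq: "p \<in> {..<r}" "q \<in> {..<r}" "w p mod (r - 1) = w q mod (r - 1)"
      then have "w p = w q"
        using block[of p] block[of q] div_neq_imp_mod_neq[of "w p" "w q" "r - 1"] by auto
      then show "p = q" using w(2) pq by (simp add: inj_on_def)
    qed
    moreover have "(\<lambda>p. w p mod (r - 1)) ` {..<r} \<subseteq> {..<r - 1}"
      using r by auto
    ultimately have "card {..<r} \<le> card {..<r - 1}"
      by (intro card_inj_on_le) auto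
    then show False using r by simp
  qed
qed

section \<open>Growth rate and conclusion\<close>

text \<open>If (2+\<epsilon>)^d stays below 2^d + 1/2, each group of \<open>d\<close> factors gains
  at least the ratio \<open>q > 1\<close>. Enough groups absorb the at most \<open>d\<close>
  remaining factors 2+\<epsilon>.\<close>

lemma power_split_eventually_ge:
  assumes "d > 0"
  shows "\<exists>\<epsilon>::real. \<epsilon> > 0 \<and>
    (\<forall>\<^sub>F L in sequentially. (2 + \<epsilon>) ^ L \<le> (2 ^ d + 1) ^ (L div d) * 2 ^ (L mod d))"
proof -
  \<comment> \<open>Continuity at 0 from the right yields a positive \<epsilon>.\<close>
  have "((\<lambda>x::real. (2 + x) ^ d) \<longlongrightarrow> (2 + 0) ^ d) (at_right 0)"
    by (intro tendsto_intros)
  then have "\<forall>\<^sub>F x::real in at_right 0. (2 + x) ^ d < 2 ^ d + 1/2"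
    by (intro order_tendstoD) auto
  moreover have "\<forall>\<^sub>F x::real in at_right 0. x > 0"
    by (simp add: eventually_at_right_less)
  ultimately have "\<forall>\<^sub>F x::real in at_right 0. (2 + x) ^ d < 2 ^ d + 1/2 \<and> x > 0"
    by (rule eventually_conj)
  then obtain \<epsilon> :: real where e: "(2 + \<epsilon>) ^ d < 2 ^ d + 1/2" "\<epsilon> > 0"
    using eventually_happens'[OF trivial_limit_at_right_real] by blast
  define q :: real where "q = (2 ^ d + 1) / (2 ^ d + 1/2)"
  have pos: "(2::real) ^ d + 1/2 > 0"
    by (intro add_pos_pos) auto
  have "q > 1" using pos by (simp add: q_def field_simps)
  then obtain t0 where "(2 + \<epsilon>) ^ d < q ^ t0"
    using real_arch_pow by blast
  moreover have "q ^ t0 \<le> q ^ t" if "t \<ge> t0" for t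
    using that \<open>q > 1\<close> by (intro power_increasing) auto
  ultimately have t0: "(2 + \<epsilon>) ^ d \<le> q ^ t" if "t \<ge> t0" for t
    using that by (meson less_imp_le order_trans)
  have "(2 + \<epsilon>) ^ L \<le> (2 ^ d + 1) ^ (L div d) * 2 ^ (L mod d)" if L: "L \<ge> t0 * d" for L
  proof -
    define t where "t = L div d"
    have "t \<ge> t0"
      using L assms by (simp add: t_def less_eq_div_iff_mult_less_eq)
    have "(2 + \<epsilon>) ^ L = ((2 + \<epsilon>) ^ d) ^ t * (2 + \<epsilon>) ^ (L mod d)"
      by (simp add: t_def flip: power_mult power_add)
    also have "\<dots> \<le> (2 ^ d + 1/2) ^ t * (2 + \<epsilon>) ^ d"
      using e assms by (intro mult_mono power_mono power_increasing) auto
    also have "\<dots> \<le> (2 ^ d + 1/2) ^ t * q ^ t"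
      using t0[OF \<open>t \<ge> t0\<close>] pos by (intro mult_left_mono) auto
    also have "\<dots> = (2 ^ d + 1) ^ t"
      using pos by (simp add: q_def flip: power_mult_distrib)
    also have "\<dots> \<le> (2 ^ d + 1) ^ t * 2 ^ (L mod d)"
      using mult_left_mono[of 1 "2 ^ (L mod d)" "(2 ^ d + 1) ^ t :: real"]
      by (simp add: add_nonneg_nonneg)
    finally show ?thesis by (simp add: t_def)
  qed
  then show ?thesis
    using e(2) by (auto simp: eventually_sequentially)
qed

theorem theorem4:
  fixes r :: nat
  assumes "odd r" and "r \<ge> 3"
  shows "\<exists>\<epsilon>::real. \<epsilon> > 0 \<and>
    (\<forall>\<^sub>F k in sequentially.
       real (ramsey_number k (cycle_graph r)) > (real r - 1) * (2 + \<epsilon>) ^ (k - 1))"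
proof -
  obtain d c where d: "d > 0" and c: "no_mono_closed_walk r (2 ^ d + 1) d c"
    using no_mono_closed_walk_beyond_power2[OF assms(1)] by blast
  obtain c2 where c2: "no_mono_closed_walk r 2 1 c2"
    using no_mono_closed_walk_two[OF assms(1)] by blast
  have "r > 0" using assms(2) by simp
  obtain \<epsilon> :: real where e: "\<epsilon> > 0"
    and ev: "\<forall>\<^sub>F L in sequentially. (2 + \<epsilon>) ^ L \<le> (2 ^ d + 1) ^ (L div d) * 2 ^ (L mod d)"
    using power_split_eventually_ge[OF d] by blast
  have bound: "real (ramsey_number (Suc L) (cycle_graph r)) > (real r - 1) * (2 + \<epsilon>) ^ L"
    if L: "(2 + \<epsilon>) ^ L \<le> (2 ^ d + 1) ^ (L div d) * 2 ^ (L mod d)" for L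
  proof -
    \<comment> \<open>Take \<open>L div d\<close> factors with \<open>d\<close> colours each and
      \<open>L mod d\<close> single edges: \<open>L\<close> colours in all. The blow-up adds one,
      hence the exponent \<open>k - 1\<close>.\<close>
    define N :: nat where "N = (2 ^ d + 1) ^ (L div d) * 2 ^ (L mod d)"
    obtain c' where "no_mono_closed_walk r N (L div d * d + L mod d * 1) c'"
      using no_mono_closed_walk_power[OF c \<open>r > 0\<close>, of "L div d"]
        no_mono_closed_walk_power[OF c2 \<open>r > 0\<close>, of "L mod d"] no_mono_closed_walk_prod
      unfolding N_def by blast
    then have "ramsey_number (L + 1) (cycle_graph r) > N * (r - 1)"
      using ramsey_number_cycle_gt[OF _ assms(2), of N L] by simp
    then have "real (ramsey_number (Suc L) (cycle_graph r)) > real (N * (r - 1))"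
      by (simp only: of_nat_less_iff Suc_eq_plus1)
    moreover have "(real r - 1) * (2 + \<epsilon>) ^ L \<le> (real r - 1) * real N"
      using L assms(2) by (intro mult_left_mono) (simp_all add: N_def add.commute)
    moreover have "real (N * (r - 1)) = (real r - 1) * real N"
      using assms(2) by (simp add: of_nat_diff)
    ultimately show ?thesis by linarith
  qed
  have "\<forall>\<^sub>F L in sequentially.
      real (ramsey_number (Suc L) (cycle_graph r)) > (real r - 1) * (2 + \<epsilon>) ^ (Suc L - 1)"
    by (rule eventually_mono[OF ev]) (simp add: bound)
  then have "\<forall>\<^sub>F k in sequentially.
      real (ramsey_number k (cycle_graph r)) > (real r - 1) * (2 + \<epsilon>) ^ (k - 1)"
    by (rule iffD1[OF eventually_sequentially_Suc])
  with e show ?thesis by blast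
qed

end
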